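(* Let $L_{\text{alg}}>0$, let $x^k\in\mathbb R^d$, let $\mathbf S_k\in\mathbb R^{d\times \tau(\mathbf S_k)}$ be a sketch matrix, and suppose $\nabla f(x^k)\in \mathrm{Range}(\nabla^2 f(x^k))$. Then the following three update rules are equivalent (they define the same point $x^{k+1}$): \begin{align*} \text{(regularized Newton)}\quad & x^{k+1}=x^k+\mathbf S_k\operatorname*{argmin}_{h\in\mathbb R^{\tau(\mathbf S_k)}} T_{\mathbf S_k}(x^k,h),\\ \text{(damped Newton)}\quad & x^{k+1}=x^k-\alpha_k\,\mathbf S_k\,[\nabla^2_{\mathbf S_k}f(x^k)]^\dagger\,\nabla_{\mathbf S_k}f(x^k),\\ \text{(sketch-and-project)}\quad & x^{k+1}=x^k-\alpha_k\,\mathbf P_{x^k}[\nabla^2 f(x^k)]^\dagger\nabla f(x^k), \end{align*} where $$T_{\mathbf S}(x,h)= f(x)+\langle\nabla f(x),\mathbf S h\rangle+\tfrac12\|\mathbf S h\|_x^2+\tfrac{L_{\text{alg}}}{6}\|\mathbf S h\|_x^3,$$ $$\alpha_k=\frac{-1+\sqrt{1+2L_{\text{alg}}\|\nabla_{\mathbf S_k}f(x^k)\|^*_{x^k,\mathbf S_k}}}{L_{\text{alg}}\|\nabla_{\mathbf S_k}f(x^k)\|^*_{x^k,\mathbf S_k}},$$ and $\mathbf P_{x^k}=\mathbf S_k\left(\mathbf S_k^\top\nabla^2 f(x^k)\mathbf S_k\right)^\dagger\mathbf S_k^\top\nabla^2 f(x^k)$ is the projection matrix onto $\mathrm{Range}(\mathbf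 S_k)$ with respect to the norm $\|\cdot\|_{x^k}$.
   Context: Throughout, $f:\mathbb R^d\to\mathbb R$ is convex, twice differentiable with positive definite Hessian, and bounded from below. $\mathbf A^\dagger$ is the Moore–Penrose pseudoinverse and $\mathrm{Range}(\mathbf A)$ the column space. The local norm at $x$ is $\|h\|_x=\langle\nabla^2 f(x)h,h\rangle^{1/2}$. For a matrix $\mathbf S\in\mathbb R^{d\times\tau(\mathbf S)}$ write $\nabla_{\mathbf S}f(x)=\mathbf S^\top\nabla f(x)$ and $\nabla^2_{\mathbf S}f(x)=\mathbf S^\top\nabla^2 f(x)\mathbf S$, and for $g\in\mathrm{Range}(\nabla_{\mathbf S}^2 f(x))$ put $\|g\|^*_{x,\mathbf S}=\langle g,[\nabla^2_{\mathbf S}f(x)]^\dagger g\rangle^{1/2}$. If $\|\nabla_{\mathbf S_k}f(x^k)\|^*_{x^k,\mathbf S_k}=0$, $\alpha_k$ is understood as its limit value $1$. *)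

theory Defs
  imports "HOL-Analysis.Analysis"
begin

(* A matrix with CARD('m) rows and CARD('n) columns has type real^'n^'m. *)

definition is_pseudoinverse :: "real^'n^'m \<Rightarrow> real^'m^'n \<Rightarrow> bool" where
  "is_pseudoinverse A X \<longleftrightarrow>
     A ** X ** A = A \<and> X ** A ** X = X \<and>
     transpose (A ** X) = A ** X \<and> transpose (X ** A) = X ** A"

(* Every real matrix has exactly one Moore-Penrose pseudoinverse. *)
definition pseudoinverse :: "real^'n^'m \<Rightarrow> real^'m^'n" where
  "pseudoinverse A = (THE X. is_pseudoinverse A X)"

definition matrix_range :: "real^'n^'m \<Rightarrow> (real^'m) set" where
  "matrix_range A = range (\<lambda>v. A *v v)"

(* Symmetry is not part of this definition. It is used only for the Hessian of a twice
   differentiable function, which is always symmetric. *)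
definition positive_definite :: "real^'n^'n \<Rightarrow> bool" where
  "positive_definite A \<longleftrightarrow> (\<forall>v. v \<noteq> 0 \<longrightarrow> (A *v v) \<bullet> v > 0)"

(* Meaningful where f is differentiable; the gradient is then unique. *)
definition gradient :: "(real^'d \<Rightarrow> real) \<Rightarrow> real^'d \<Rightarrow> real^'d" where
  "gradient f x = (THE g. GDERIV f x :> g)"

definition twice_differentiable :: "(real^'d \<Rightarrow> real) \<Rightarrow> bool" where
  "twice_differentiable f \<longleftrightarrow>
     (\<forall>x. f differentiable (at x)) \<and> (\<forall>x. gradient f differentiable (at x))"

definition hessian :: "(real^'d \<Rightarrow> real) \<Rightarrow> real^'d \<Rightarrow> real^'d^'d" where
  "hessian f x = jacobian (gradient f) (at x)"

definition local_norm :: "(real^'d \<Rightarrow> real) \<Rightarrow> real^'d \<Rightarrow> real^'d \<Rightarrow> real" where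
  "local_norm f x h = sqrt ((hessian f x *v h) \<bullet> h)"

definition sketched_gradient ::
  "(real^'d \<Rightarrow> real) \<Rightarrow> real^'t^'d \<Rightarrow> real^'d \<Rightarrow> real^'t" where
  "sketched_gradient f S x = transpose S *v gradient f x"

definition sketched_hessian ::
  "(real^'d \<Rightarrow> real) \<Rightarrow> real^'t^'d \<Rightarrow> real^'d \<Rightarrow> real^'t^'t" where
  "sketched_hessian f S x = transpose S ** hessian f x ** S"

(* Intended for g in the range of the sketched Hessian. *)
definition dual_norm ::
  "(real^'d \<Rightarrow> real) \<Rightarrow> real^'d \<Rightarrow> real^'t^'d \<Rightarrow> real^'t \<Rightarrow> real" where
  "dual_norm f x S g = sqrt (g \<bullet> (pseudoinverse (sketched_hessian f S x) *v g))"

definition newton_model ::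
  "real \<Rightarrow> (real^'d \<Rightarrow> real) \<Rightarrow> real^'t^'d \<Rightarrow> real^'d \<Rightarrow> real^'t \<Rightarrow> real" where
  "newton_model L f S x h =
     f x + gradient f x \<bullet> (S *v h) + 1 / 2 * (local_norm f x (S *v h))^2
       + L / 6 * (local_norm f x (S *v h))^3"

(* The value 1 at G = 0 is the limit of the quotient as G tends to 0. *)
definition stepsize ::
  "real \<Rightarrow> (real^'d \<Rightarrow> real) \<Rightarrow> real^'t^'d \<Rightarrow> real^'d \<Rightarrow> real" where
  "stepsize L f S x =
     (let G = dual_norm f x S (sketched_gradient f S x)
      in if G = 0 then 1 else (- 1 + sqrt (1 + 2 * L * G)) / (L * G))"

definition projection_matrix ::
  "(real^'d \<Rightarrow> real) \<Rightarrow> real^'t^'d \<Rightarrow> real^'d \<Rightarrow> real^'d^'d" where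
  "projection_matrix f S x =
     S ** pseudoinverse (transpose S ** hessian f x ** S) ** transpose S ** hessian f x"

(* P maps each point to a nearest point of V, with distances measured by N. *)
definition is_projection_onto ::
  "(real^'d \<Rightarrow> real) \<Rightarrow> (real^'d) set \<Rightarrow> real^'d^'d \<Rightarrow> bool" where
  "is_projection_onto N V P \<longleftrightarrow>
     (\<forall>y. is_arg_min (\<lambda>z. N (y - z)) (\<lambda>z. z \<in> V) (P *v y))"

end

theory Submission
  imports Defs
begin

text \<open>
  Write \<open>H\<close> for the Hessian, \<open>g\<close> for the gradient, \<open>M = S\<^sup>T H S\<close>, \<open>c = S\<^sup>T g\<close>, and \<open>N\<close> for the
  local norm.  Everything rests on the fact that \<open>S\<^sup>T v\<close> always lies in the range of \<open>M\<close>
  (\<open>transpose_mult_vec_in_range_congruence\<close>): a kernel vector \<open>r\<close> of \<open>M\<close> satisfies \<open>N (S r) = 0\<close>,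
  so \<open>S r = 0\<close>, and \<open>S\<^sup>T v\<close> is orthogonal to \<open>r\<close>.  Hence \<open>d = M\<^sup>\<dagger> c\<close> solves the normal equation
  \<open>M d = c\<close>.

  With \<open>w = - S d\<close>, the normal equation turns the linear term \<open>g \<bullet> S h\<close> of the cubic model into
  \<open>- \<langle>H w, S h\<rangle>\<close>, and the dual norm of \<open>c\<close> into \<open>N w\<close>.  The model is then a function of \<open>u = S h\<close>
  alone, built from the \<open>H\<close>-inner product.  The stepsize \<open>\<alpha>\<close> is the positive root of
  \<open>\<alpha> + L N(w) \<alpha>\<^sup>2 / 2 = 1\<close>, and this equation yields an exact formula for the excess of the model
  at \<open>u\<close> over its value at \<open>\<alpha> w\<close> (\<open>cubic_model_gap\<close>), namely, with \<open>q = N u\<close> and \<open>p = \<alpha> N w\<close>,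
  \<open>N(u - \<alpha> w)\<^sup>2 / (2 \<alpha>) + L (q - p)\<^sup>2 (2 q + p) / 12\<close>.  It is nonnegative and vanishes only at
  \<open>u = \<alpha> w\<close>.  So regularized and damped Newton steps coincide; \<open>h\<close> itself need not be unique,
  but \<open>S h\<close> is.

  The sketch-and-project form follows from \<open>H H\<^sup>\<dagger> g = g\<close>.  That \<open>P\<close> is the \<open>H\<close>-projection is the
  Pythagorean identity: the range fact applied to \<open>S\<^sup>T (H y)\<close> says \<open>S\<^sup>T H (y - P y) = 0\<close>.

  Two ingredients are general.  Symmetry of \<open>H\<close>, used throughout, holds at each point where
  the gradient is differentiable (\<open>symmetric_gradient_derivative\<close>).  The
  pseudoinverse is defined by a unique description, so its existence and uniqueness come first.
\<close>

section \<open>Existence and uniqueness of the pseudoinverse\<close>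

text \<open>
  The simplifier would otherwise write \<open>S\<^sup>T v\<close> as a row vector times \<open>S\<close>, which hides compositions
  with \<open>S\<^sup>T\<close> from the matrix product laws.
\<close>

declare transpose_matrix_vector [simp del]

lemma inner_matrix_transpose:
  fixes A :: "real^'n^'m"
  shows "u \<bullet> (A *v v) = (transpose A *v u) \<bullet> v"
  by (simp add: transpose_matrix_vector dot_lmul_matrix)

text \<open>
  Split an element of the range of \<open>A\<close> along the range of \<open>A A\<^sup>T\<close> and its orthogonal complement.
  The orthogonal part \<open>q\<close> satisfies \<open>A\<^sup>T q = 0\<close>, so it is orthogonal to the range of \<open>A\<close>; being
  also inside that range, it is zero.
\<close>

lemma matrix_range_gram:
  fixes A :: "real^'n^'m"
  shows "matrix_range (A ** transpose A) = matrix_range A"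
proof
  show "matrix_range (A ** transpose A) \<subseteq> matrix_range A"
    by (auto simp: matrix_range_def simp flip: matrix_vector_mul_assoc)
  show "matrix_range A \<subseteq> matrix_range (A ** transpose A)"
  proof
    fix w assume "w \<in> matrix_range A"
    then obtain u where u: "w = A *v u" by (auto simp: matrix_range_def)
    define R where "R = matrix_range (A ** transpose A)"
    have R: "subspace R"
      unfolding R_def matrix_range_def
      by (intro linear_subspace_image subspace_UNIV) simp
    obtain p q where p: "p \<in> span R" and q: "\<And>r. r \<in> span R \<Longrightarrow> orthogonal q r" and w: "w = p + q"
      using orthogonal_subspace_decomp_exists[of R w] by metis
    from p R have pR: "p \<in> R" by (metis span_eq_iff)
    then obtain y where y: "p = A *v (transpose A *v y)"
      by (auto simp: R_def matrix_range_def simp flip: matrix_vector_mul_assoc)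
    have "(A ** transpose A) *v q \<in> span R"
      by (intro span_base) (auto simp: R_def matrix_range_def)
    then have "q \<bullet> ((A ** transpose A) *v q) = 0"
      using q by (auto simp: orthogonal_def)
    then have "(transpose A *v q) \<bullet> (transpose A *v q) = 0"
      by (simp add: inner_matrix_transpose flip: matrix_vector_mul_assoc)
    then have "transpose A *v q = 0" by simp
    moreover have "q = A *v (u - transpose A *v y)"
      using w u y by (simp add: algebra_simps)
    ultimately have "q \<bullet> q = 0"
      by (metis inner_matrix_transpose inner_zero_left)
    with w pR show "w \<in> matrix_range (A ** transpose A)" by (simp add: R_def)
  qed
qed

lemma matrix_factor_if_range_subset:
  fixes A :: "real^'n^'m" and M :: "real^'k^'m"
  assumes "matrix_range A \<subseteq> matrix_range M"
  obtains B where "A = M ** B"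
proof -
  have "\<exists>b. A *v axis j 1 = M *v b" for j
    using assms by (auto simp: matrix_range_def)
  then obtain b where b: "\<And>j. A *v axis j 1 = M *v b j" by metis
  have "A = M ** (\<chi> i j. b j $ i)"
  proof (simp add: vec_eq_iff, intro allI)
    fix i j
    have "A $ i $ j = (A *v axis j 1) $ i"
      by (simp add: matrix_vector_mult_basis column_def)
    also have "\<dots> = (M *v b j) $ i" by (simp add: b)
    also have "\<dots> = (M ** (\<chi> i j. b j $ i)) $ i $ j"
      by (simp add: matrix_vector_mult_def matrix_matrix_mult_def)
    finally show "A $ i $ j = (M ** (\<chi> i j. b j $ i)) $ i $ j" .
  qed
  then show thesis by (rule that)
qed

text \<open>
  The range identity for \<open>A\<close> and for \<open>A\<^sup>T\<close> gives factorizations \<open>A = A (A\<^sup>T B)\<close> and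
  \<open>A\<^sup>T = A\<^sup>T (A C)\<close>.  The factors \<open>E = A\<^sup>T B\<close> and \<open>F = A C\<close> are the orthogonal projections onto the
  row and the column space of \<open>A\<close>: each is symmetric because it equals its own Gram matrix.
  Then \<open>X = E C\<close> satisfies \<open>A X = F\<close> and \<open>X A = E\<close>, and the four Penrose equations are
  properties of these projections.
\<close>

lemma is_pseudoinverse_exists:
  fixes A :: "real^'n^'m"
  shows "\<exists>X. is_pseudoinverse A X"
proof -
  obtain B where "A = (A ** transpose A) ** B"
    using matrix_factor_if_range_subset matrix_range_gram by blast
  then have B: "A = A ** (transpose A ** B)" by (simp add: matrix_mul_assoc)
  obtain C where "transpose A = (transpose A ** transpose (transpose A)) ** C"
    using matrix_factor_if_range_subset matrix_range_gram by blast
  then have C: "transpose A = transpose A ** (A ** C)" by (simp add: matrix_mul_assoc)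
  define E where "E = transpose A ** B"
  define F where "F = A ** C"
  have AE: "A = A ** E" using B by (simp add: E_def)
  have "transpose E = transpose E ** E"
    using arg_cong[OF AE, of "\<lambda>Z. transpose B ** Z"]
    by (simp add: E_def matrix_transpose_mul matrix_mul_assoc)
  then have symE: "transpose E = E"
    by (metis matrix_transpose_mul transpose_transpose)
  have CF: "transpose A = transpose A ** F" using C by (simp add: F_def)
  have "transpose F = transpose F ** F"
    using arg_cong[OF CF, of "\<lambda>Z. transpose C ** Z"]
    by (simp add: F_def matrix_transpose_mul matrix_mul_assoc)
  then have symF: "transpose F = F"
    by (metis matrix_transpose_mul transpose_transpose)
  have FA: "F ** A = A"
    using arg_cong[OF CF, of transpose] by (simp add: matrix_transpose_mul symF)
  have EBA: "E = transpose B ** A"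
    using symE by (simp add: E_def matrix_transpose_mul)
  have EE: "E ** E = E"
    using AE EBA by (metis matrix_mul_assoc)
  define X where "X = E ** C"
  have AX: "A ** X = F"
    using AE by (metis F_def X_def matrix_mul_assoc)
  have "X ** A = transpose B ** (F ** A)"
    by (simp add: X_def F_def EBA matrix_mul_assoc)
  then have XA: "X ** A = E" by (simp add: FA EBA)
  have "is_pseudoinverse A X"
    unfolding is_pseudoinverse_def AX XA
    using FA symE symF EE by (simp add: X_def matrix_mul_assoc)
  then show ?thesis ..
qed

text \<open>
  Penrose's argument: \<open>A X\<close> and \<open>A Y\<close> are symmetric idempotents with the same range, so each
  absorbs the other, and transposing the product shows that they agree.  The same holds for
  \<open>X A\<close> and \<open>Y A\<close>.
\<close>

lemma is_pseudoinverse_unique: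
  assumes "is_pseudoinverse A X" "is_pseudoinverse A Y"
  shows "X = Y"
proof -
  have *: "A ** Z ** A = A" "Z ** A ** Z = Z" "transpose (A ** Z) = A ** Z"
      "transpose (Z ** A) = Z ** A" if "is_pseudoinverse A Z" for Z
    using that by (simp_all add: is_pseudoinverse_def)
  note X = *[OF assms(1)] and Y = *[OF assms(2)]
  have "A ** X = transpose ((A ** Y) ** (A ** X))"
    using X(3) Y(1) by (simp add: matrix_mul_assoc)
  also have "\<dots> = (A ** X) ** (A ** Y)"
    by (subst matrix_transpose_mul) (simp only: X Y)
  also have "\<dots> = A ** Y" using X(1) by (simp add: matrix_mul_assoc)
  finally have AXY: "A ** X = A ** Y" .
  have "X ** A = transpose ((X ** A) ** (Y ** A))"
    using X(4) Y(1) by (metis matrix_mul_assoc)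
  also have "\<dots> = (Y ** A) ** (X ** A)"
    by (subst matrix_transpose_mul) (simp only: X Y)
  also have "\<dots> = Y ** A" using X(1) by (metis matrix_mul_assoc)
  finally have XAY: "X ** A = Y ** A" .
  have "X = X ** A ** X" by (simp only: X)
  also have "\<dots> = Y ** A ** Y"
    using AXY XAY by (metis matrix_mul_assoc)
  finally show ?thesis by (simp only: Y)
qed

lemma is_pseudoinverse_pseudoinverse: "is_pseudoinverse A (pseudoinverse A)"
  unfolding pseudoinverse_def
  using is_pseudoinverse_exists is_pseudoinverse_unique by (metis theI)

lemma mult_pseudoinverse_mult_vec_range:
  assumes "v \<in> matrix_range A"
  shows "A *v (pseudoinverse A *v v) = v"
  using assms is_pseudoinverse_pseudoinverse[of A]
  by (auto simp: matrix_range_def is_pseudoinverse_def matrix_vector_mul_assoc)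

section \<open>Symmetry of the Hessian\<close>

lemma GDERIV_unique:
  assumes "GDERIV f x :> a" "GDERIV f x :> b"
  shows "a = b"
proof -
  have "(\<lambda>h. h \<bullet> a) = (\<lambda>h. h \<bullet> b)"
    using assms unfolding gderiv_def by (rule has_derivative_unique)
  then have "(a - b) \<bullet> a = (a - b) \<bullet> b" by metis
  then have "(a - b) \<bullet> (a - b) = 0" by (simp add: inner_diff_right)
  then show ?thesis by simp
qed

lemma GDERIV_gradient:
  fixes f :: "real^'d \<Rightarrow> real"
  assumes "f differentiable (at x)"
  shows "GDERIV f x :> gradient f x"
proof -
  obtain D where D: "(f has_derivative D) (at x)"
    using assms by (auto simp: differentiable_def)
  then interpret linear D
    by (metis has_derivative_linear)
  have "D = (\<lambda>h. h \<bullet> adjoint D 1)"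
    using adjoint_works[OF linear_axioms, of _ 1] by auto
  with D have "GDERIV f x :> adjoint D 1"
    by (simp add: gderiv_def)
  then show ?thesis
    unfolding gradient_def using GDERIV_unique by (metis theI)
qed

text \<open>
  Only the differentiability of \<open>G\<close> at the single point \<open>x\<close> is available, so the estimate must
  not use a second derivative anywhere else.  One mean value step in direction \<open>u\<close> reduces the
  second difference to \<open>t (u \<bullet> (G (x + a) - G (x + b)))\<close> with \<open>a - b = t v\<close>; both gradients are
  then compared with the linearization of \<open>G\<close> at \<open>x\<close>.
\<close>

lemma second_difference_estimate:
  fixes f :: "'a::real_inner \<Rightarrow> real"
  assumes G: "\<And>y. GDERIV f y :> G y"
    and D: "(G has_derivative D) (at x)"
    and e: "e > 0"
  shows "\<exists>d>0. \<forall>t. 0 < t \<and> t < d \<longrightarrow>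
    \<bar>f (x + t *\<^sub>R u + t *\<^sub>R v) - f (x + t *\<^sub>R u) - f (x + t *\<^sub>R v) + f x - t\<^sup>2 * (u \<bullet> D v)\<bar>
      \<le> 2 * e * t\<^sup>2 * (norm u + norm v)\<^sup>2"
proof -
  interpret D: bounded_linear D using D by (rule has_derivative_bounded_linear)
  define K where "K = norm u + norm v"
  have K: "K \<ge> 0" by (simp add: K_def)
  obtain d where d: "d > 0"
    and est: "\<And>y. norm (y - x) < d \<Longrightarrow> norm (G y - G x - D (y - x)) \<le> e * norm (y - x)"
    using D e unfolding has_derivative_at_alt by blast
  \<comment> \<open>All points involved lie within \<open>t * K\<close> of \<open>x\<close>; the \<open>+ 1\<close> keeps the threshold positive for \<open>K = 0\<close>.\<close>
  have "\<bar>f (x + t *\<^sub>R u + t *\<^sub>R v) - f (x + t *\<^sub>R u) - f (x + t *\<^sub>R v) + f x - t\<^sup>2 * (u \<bullet> D v)\<bar>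
      \<le> 2 * e * t\<^sup>2 * K\<^sup>2" if t: "0 < t" "t < d / (K + 1)" for t
  proof -
    define g where "g = (\<lambda>s. f (x + t *\<^sub>R v + s *\<^sub>R (t *\<^sub>R u)) - f (x + s *\<^sub>R (t *\<^sub>R u)))"
    have der: "(g has_derivative (\<lambda>r. r * t * (u \<bullet> (G (x + t *\<^sub>R v + s *\<^sub>R (t *\<^sub>R u)) - G (x + s *\<^sub>R (t *\<^sub>R u))))))
        (at s within {0..1})" for s
    proof -
      have line: "((\<lambda>s. f (z + s *\<^sub>R (t *\<^sub>R u))) has_derivative
          (\<lambda>r. (r *\<^sub>R (t *\<^sub>R u)) \<bullet> G (z + s *\<^sub>R (t *\<^sub>R u)))) (at s within {0..1})" for z
      proof (rule has_derivative_compose[where f = "\<lambda>s. z + s *\<^sub>R (t *\<^sub>R u)"])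
        show "((\<lambda>s. z + s *\<^sub>R (t *\<^sub>R u)) has_derivative (\<lambda>r. r *\<^sub>R (t *\<^sub>R u))) (at s within {0..1})"
          by (auto intro!: derivative_eq_intros)
        show "(f has_derivative (\<lambda>h. h \<bullet> G (z + s *\<^sub>R (t *\<^sub>R u)))) (at (z + s *\<^sub>R (t *\<^sub>R u)))"
          using G by (simp add: gderiv_def)
      qed
      show ?thesis
        unfolding g_def
        using has_derivative_diff[OF line[of "x + t *\<^sub>R v"] line[of x]]
        by (simp add: algebra_simps)
    qed
    obtain s where s: "0 < s" "s < 1"
      and gs: "g 1 - g 0 = t * (u \<bullet> (G (x + t *\<^sub>R v + s *\<^sub>R (t *\<^sub>R u)) - G (x + s *\<^sub>R (t *\<^sub>R u))))"
      using mvt_simple[of 0 1 g, OF _ der] by auto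
    define a where "a = t *\<^sub>R v + s *\<^sub>R (t *\<^sub>R u)"
    define b where "b = s *\<^sub>R (t *\<^sub>R u)"
    have su: "s * (t * norm u) \<le> t * norm u"
      using s t by (simp add: mult_left_le_one_le)
    have na: "norm a \<le> t * K"
    proof -
      have "norm a \<le> t * norm v + s * (t * norm u)"
        using norm_triangle_ineq[of "t *\<^sub>R v" "s *\<^sub>R (t *\<^sub>R u)"] s t by (simp add: a_def)
      then show ?thesis using su by (simp add: K_def distrib_left)
    qed
    have nb: "norm b \<le> t * K"
      using su s t by (simp add: b_def K_def algebra_simps add_increasing2)
    have "t * (K + 1) < d" using t K by (simp add: pos_less_divide_eq)
    then have tK: "t * K < d" using t by (simp add: algebra_simps)
    have ra: "norm (G (x + a) - G x - D a) \<le> e * (t * K)"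
      using est[of "x + a"] na tK e by (simp add: order_trans[OF _ mult_left_mono])
    have rb: "norm (G (x + b) - G x - D b) \<le> e * (t * K)"
      using est[of "x + b"] nb tK e by (simp add: order_trans[OF _ mult_left_mono])
    have Dab: "D a - D b = t *\<^sub>R D v"
      by (simp add: a_def b_def D.add D.scaleR)
    define r where "r = (G (x + a) - G x - D a) - (G (x + b) - G x - D b)"
    have nr: "norm r \<le> 2 * e * t * K"
      using norm_triangle_ineq4[of "G (x + a) - G x - D a" "G (x + b) - G x - D b"] ra rb
      by (simp add: r_def)
    have Gab: "G (x + a) - G (x + b) = t *\<^sub>R D v + r"
      by (simp add: r_def flip: Dab)
    have "g 1 - g 0 = t * (u \<bullet> (G (x + a) - G (x + b)))"
      using gs by (simp add: a_def b_def add.assoc)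
    also have "\<dots> = t\<^sup>2 * (u \<bullet> D v) + t * (u \<bullet> r)"
      unfolding Gab by (simp add: inner_add_right algebra_simps power2_eq_square)
    finally have "g 1 - g 0 - t\<^sup>2 * (u \<bullet> D v) = t * (u \<bullet> r)" by simp
    moreover have "\<bar>t * (u \<bullet> r)\<bar> \<le> 2 * e * t\<^sup>2 * K\<^sup>2"
    proof -
      have "\<bar>u \<bullet> r\<bar> \<le> norm u * norm r" by (rule Cauchy_Schwarz_ineq2)
      also have "\<dots> \<le> K * (2 * e * t * K)"
        using nr K by (intro mult_mono) (auto simp: K_def)
      finally have "t * \<bar>u \<bullet> r\<bar> \<le> t * (K * (2 * e * t * K))"
        using t by simp
      then show ?thesis using t by (simp add: abs_mult power2_eq_square algebra_simps)
    qed
    moreover have "g 1 - g 0 = f (x + t *\<^sub>R u + t *\<^sub>R v) - f (x + t *\<^sub>R u) - f (x + t *\<^sub>R v) + f x"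
      by (simp add: g_def algebra_simps)
    ultimately show ?thesis by simp
  qed
  moreover have "d / (K + 1) > 0" using d K by simp
  ultimately show ?thesis unfolding K_def by blast
qed

text \<open>
  The second difference is symmetric in \<open>u\<close> and \<open>v\<close>, and by the preceding estimate it is
  \<open>t\<^sup>2 (u \<bullet> D v)\<close> as well as \<open>t\<^sup>2 (v \<bullet> D u)\<close> up to an error of arbitrarily small order \<open>e t\<^sup>2\<close>.
\<close>

lemma symmetric_gradient_derivative:
  fixes f :: "'a::real_inner \<Rightarrow> real"
  assumes G: "\<And>y. GDERIV f y :> G y"
    and D: "(G has_derivative D) (at x)"
  shows "u \<bullet> D v = v \<bullet> D u"
proof -
  define K where "K = norm u + norm v"
  have bound: "\<bar>u \<bullet> D v - v \<bullet> D u\<bar> \<le> e * (4 * K\<^sup>2)" if e: "e > 0" for e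
  proof -
    obtain d1 where d1: "d1 > 0" "\<And>t. 0 < t \<and> t < d1 \<Longrightarrow>
      \<bar>f (x + t *\<^sub>R u + t *\<^sub>R v) - f (x + t *\<^sub>R u) - f (x + t *\<^sub>R v) + f x - t\<^sup>2 * (u \<bullet> D v)\<bar>
        \<le> 2 * e * t\<^sup>2 * K\<^sup>2"
      using second_difference_estimate[OF G D e, of u v] by (auto simp: K_def)
    obtain d2 where d2: "d2 > 0" "\<And>t. 0 < t \<and> t < d2 \<Longrightarrow>
      \<bar>f (x + t *\<^sub>R v + t *\<^sub>R u) - f (x + t *\<^sub>R v) - f (x + t *\<^sub>R u) + f x - t\<^sup>2 * (v \<bullet> D u)\<bar>
        \<le> 2 * e * t\<^sup>2 * K\<^sup>2"
      using second_difference_estimate[OF G D e, of v u] by (auto simp: K_def add.commute)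
    define t where "t = min d1 d2 / 2"
    have t: "t > 0" "t < d1" "t < d2" using d1(1) d2(1) by (auto simp: t_def)
    have "x + t *\<^sub>R v + t *\<^sub>R u = x + t *\<^sub>R u + t *\<^sub>R v" by simp
    then have "\<bar>t\<^sup>2 * (u \<bullet> D v) - t\<^sup>2 * (v \<bullet> D u)\<bar> \<le> 2 * (2 * e * t\<^sup>2 * K\<^sup>2)"
      using d1(2)[of t] d2(2)[of t] t by (smt (verit))
    then have "t\<^sup>2 * \<bar>u \<bullet> D v - v \<bullet> D u\<bar> \<le> t\<^sup>2 * (e * (4 * K\<^sup>2))"
      by (simp add: abs_mult flip: right_diff_distrib) (simp add: algebra_simps)
    then show ?thesis using t by simp
  qed
  have "\<bar>u \<bullet> D v - v \<bullet> D u\<bar> \<le> 0 + e" if "e > 0" for e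
  proof -
    have "e / (4 * K\<^sup>2 + 1) * (4 * K\<^sup>2) \<le> e"
      using that by (simp add: field_simps add_pos_nonneg)
    moreover have "e / (4 * K\<^sup>2 + 1) > 0" using that by (simp add: add_nonneg_pos)
    ultimately show ?thesis using bound[of "e / (4 * K\<^sup>2 + 1)"] by linarith
  qed
  then have "\<bar>u \<bullet> D v - v \<bullet> D u\<bar> \<le> 0" by (rule field_le_epsilon)
  then show ?thesis by simp
qed

lemma transpose_hessian:
  fixes f :: "real^'d \<Rightarrow> real"
  assumes "twice_differentiable f"
  shows "transpose (hessian f x) = hessian f x"
proof -
  have "GDERIV f y :> gradient f y" for y
    using assms by (simp add: twice_differentiable_def GDERIV_gradient)
  moreover have "(gradient f has_derivative (*v) (hessian f x)) (at x)"
    using assms by (simp add: twice_differentiable_def hessian_def jacobian_works)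
  ultimately have sym: "u \<bullet> (hessian f x *v v) = v \<bullet> (hessian f x *v u)" for u v
    by (rule symmetric_gradient_derivative)
  have "(transpose (hessian f x) *v v) \<bullet> u = (hessian f x *v v) \<bullet> u" for u v
    using sym by (metis inner_commute inner_matrix_transpose)
  then have "transpose (hessian f x) *v v = hessian f x *v v" for v
    by (metis vector_eq_rdot)
  then show ?thesis by (simp add: matrix_eq)
qed


section \<open>The normal equation and the projection\<close>

text \<open>
  With \<open>M = S\<^sup>T H S\<close> and \<open>E = M M\<^sup>\<dagger>\<close>, the orthogonal projection onto the range of \<open>M\<close>, the
  residual \<open>r\<close> of \<open>c = S\<^sup>T v\<close> lies in the kernel of \<open>M\<close>.  Definiteness of \<open>H\<close> then gives \<open>S r = 0\<close>,
  whence \<open>c\<close> is orthogonal to \<open>r\<close>; since \<open>E c\<close> is orthogonal to \<open>r\<close> as well, \<open>r = c - E c\<close> is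
  orthogonal to itself.
\<close>

lemma transpose_mult_vec_in_range_congruence:
  fixes H :: "real^'d^'d" and S :: "real^'t^'d"
  assumes sym: "transpose H = H" and pd: "positive_definite H"
  shows "transpose S *v v \<in> matrix_range (transpose S ** H ** S)"
proof -
  define M where "M = transpose S ** H ** S"
  define E where "E = M ** pseudoinverse M"
  have symM: "transpose M = M"
    by (simp add: M_def matrix_transpose_mul sym matrix_mul_assoc)
  have E: "E ** M = M" "transpose E = E"
    using is_pseudoinverse_pseudoinverse[of M] by (simp_all add: is_pseudoinverse_def E_def)
  have ME: "M ** E = M"
    using arg_cong[OF E(1), of transpose] by (simp add: matrix_transpose_mul E(2) symM)
  define c where "c = transpose S *v v"
  define r where "r = c - E *v c"
  have Mr: "M *v r = 0"
    by (simp add: r_def matrix_vector_mult_diff_distrib matrix_vector_mul_assoc ME)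
  have "(H *v (S *v r)) \<bullet> (S *v r) = (M *v r) \<bullet> r"
    by (simp add: M_def inner_matrix_transpose flip: matrix_vector_mul_assoc)
  then have "S *v r = 0"
    using pd Mr unfolding positive_definite_def by (metis inner_zero_left less_irrefl)
  then have cr: "c \<bullet> r = 0"
    by (simp add: c_def flip: inner_matrix_transpose)
  have "(E *v c) \<bullet> r = c \<bullet> (E *v r)"
    using E(2) by (simp add: inner_matrix_transpose)
  also have "E *v r = 0"
    using is_pseudoinverse_pseudoinverse[of M]
    by (simp add: r_def E_def is_pseudoinverse_def matrix_vector_mult_diff_distrib
        matrix_vector_mul_assoc matrix_mul_assoc)
  finally have "r \<bullet> r = 0"
    using cr by (simp add: r_def inner_diff_left)
  then have "c = M *v (pseudoinverse M *v c)"
    by (simp add: r_def E_def matrix_vector_mul_assoc)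
  then show ?thesis
    unfolding matrix_range_def c_def M_def by blast
qed

text \<open>
  The error \<open>y - P y\<close> is \<open>H\<close>-orthogonal to the range of \<open>S\<close>, by the normal equation with
  right-hand side \<open>S\<^sup>T (H y)\<close>; the Pythagorean identity does the rest.
\<close>

lemma projection_matrix_is_projection:
  fixes f :: "real^'d \<Rightarrow> real" and S :: "real^'t^'d"
  assumes sym: "transpose (hessian f x) = hessian f x" and pd: "positive_definite (hessian f x)"
  shows "is_projection_onto (local_norm f x) (matrix_range S) (projection_matrix f S x)"
  unfolding is_projection_onto_def
proof
  fix y
  define H where "H = hessian f x"
  define P where "P = projection_matrix f S x"
  define e where "e = y - P *v y"
  have psd: "(H *v v) \<bullet> v \<ge> 0" for v
    using pd by (cases "v = 0") (auto simp: H_def positive_definite_def less_imp_le)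
  have Py: "P *v y = S *v (pseudoinverse (transpose S ** H ** S) *v (transpose S *v (H *v y)))"
    by (simp add: P_def H_def projection_matrix_def matrix_vector_mul_assoc matrix_mul_assoc)
  have "transpose S *v (H *v (P *v y)) = transpose S *v (H *v y)"
    using mult_pseudoinverse_mult_vec_range[OF transpose_mult_vec_in_range_congruence
        [OF sym pd, of S "H *v y", folded H_def]]
    by (simp add: Py matrix_vector_mul_assoc matrix_mul_assoc)
  then have Se: "transpose S *v (H *v e) = 0"
    by (simp add: e_def matrix_vector_mult_diff_distrib)
  have le: "local_norm f x (y - P *v y) \<le> local_norm f x (y - z)" if "z \<in> matrix_range S" for z
  proof -
    from that Py obtain u where u: "P *v y - z = S *v u"
      unfolding matrix_range_def by (metis matrix_vector_mult_diff_distrib rangeE)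
    have orth: "(H *v e) \<bullet> (S *v u) = 0"
      by (simp add: inner_matrix_transpose Se)
    then have orth': "(H *v (S *v u)) \<bullet> e = 0"
      using sym unfolding H_def by (metis inner_commute inner_matrix_transpose)
    have "y - z = e + S *v u" using u by (simp add: e_def algebra_simps)
    then have "(H *v (y - z)) \<bullet> (y - z) = (H *v e) \<bullet> e + (H *v (S *v u)) \<bullet> (S *v u)"
      using orth orth' by (simp add: matrix_vector_right_distrib inner_add_left inner_add_right)
    then show ?thesis
      using psd[of "S *v u"] by (simp add: local_norm_def e_def flip: H_def)
  qed
  have "P *v y \<in> matrix_range S" by (simp add: Py matrix_range_def)
  with le show "is_arg_min (\<lambda>z. local_norm f x (y - z)) (\<lambda>z. z \<in> matrix_range S)
      (projection_matrix f S x *v y)"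
    by (auto simp: is_arg_min_def not_less simp flip: P_def)
qed

section \<open>Minimizers of the cubic model\<close>

text \<open>
  Let \<open>q = N u\<close>, \<open>n = N w\<close>, \<open>p = \<alpha> n\<close>.  The equation for \<open>\<alpha>\<close> says \<open>1 / \<alpha> = k\<close> with
  \<open>k = 1 + L p / 2\<close>.  Expanding \<open>N (u - \<alpha> w)\<^sup>2\<close> and dividing by \<open>2 \<alpha>\<close> reproduces the linear term of
  \<open>\<phi> u\<close> exactly; what is left depends on \<open>q\<close> and \<open>p\<close> only and is
  \<open>L / 12 * (2 q\<^sup>3 - 3 p q\<^sup>2 + p\<^sup>3)\<close>, which has the double root \<open>q = p\<close>.
\<close>

lemma cubic_model_gap:
  fixes H :: "real^'d^'d" and u w :: "real^'d" and L \<alpha> :: real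
  defines "N \<equiv> \<lambda>v. sqrt ((H *v v) \<bullet> v)"
  defines "\<phi> \<equiv> \<lambda>v. - ((H *v w) \<bullet> v) + 1 / 2 * (N v)\<^sup>2 + L / 6 * (N v)^3"
  assumes sym: "transpose H = H" and psd: "\<And>v. (H *v v) \<bullet> v \<ge> 0"
    and \<alpha>: "\<alpha> > 0" "\<alpha> * (1 + L * \<alpha> * N w / 2) = 1"
  shows "\<phi> u - \<phi> (\<alpha> *\<^sub>R w) =
    (N (u - \<alpha> *\<^sub>R w))\<^sup>2 / (2 * \<alpha>) + L / 12 * (N u - \<alpha> * N w)\<^sup>2 * (2 * N u + \<alpha> * N w)"
proof -
  define X where "X = (H *v w) \<bullet> u"
  define q where "q = N u"
  define n where "n = N w"
  define k where "k = 1 + L * \<alpha> * n / 2"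
  have N2: "(N v)\<^sup>2 = (H *v v) \<bullet> v" for v
    using psd by (simp add: N_def)
  have N\<alpha>: "N (\<alpha> *\<^sub>R w) = \<alpha> * n"
    using \<alpha>(1) by (simp add: N_def n_def matrix_vector_mult_scaleR real_sqrt_mult)
  have "(H *v u) \<bullet> w = X"
    unfolding X_def using sym by (metis inner_commute inner_matrix_transpose)
  then have D: "(N (u - \<alpha> *\<^sub>R w))\<^sup>2 = q\<^sup>2 - 2 * \<alpha> * X + \<alpha>\<^sup>2 * n\<^sup>2"
    unfolding q_def n_def N2
    by (simp add: X_def matrix_vector_mult_diff_distrib matrix_vector_mult_scaleR
        inner_diff_left inner_diff_right power2_eq_square algebra_simps)
  have k: "\<alpha> * k = 1" using \<alpha>(2) by (simp add: k_def n_def)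
  then have inv: "1 / \<alpha> = k" using \<alpha>(1) by (simp add: field_simps)
  have "(N (u - \<alpha> *\<^sub>R w))\<^sup>2 / (2 * \<alpha>) = (q\<^sup>2 - 2 * \<alpha> * X + \<alpha>\<^sup>2 * n\<^sup>2) * (1 / \<alpha>) / 2"
    by (simp add: D)
  also have "\<dots> = q\<^sup>2 * k / 2 - X * (\<alpha> * k) + \<alpha>\<^sup>2 * n\<^sup>2 * k / 2"
    unfolding inv by (simp add: field_simps)
  finally have D': "(N (u - \<alpha> *\<^sub>R w))\<^sup>2 / (2 * \<alpha>) = q\<^sup>2 * k / 2 - X + \<alpha>\<^sup>2 * n\<^sup>2 * k / 2"
    by (simp add: k)
  have "\<phi> (\<alpha> *\<^sub>R w) = - (\<alpha> * n\<^sup>2) + 1 / 2 * (\<alpha> * n)\<^sup>2 + L / 6 * (\<alpha> * n)^3"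
    by (simp add: \<phi>_def N\<alpha> n_def flip: N2[of w])
  \<comment> \<open>Inserting the factor \<open>\<alpha> * k = 1\<close> makes the final claim a polynomial identity.\<close>
  also have "\<alpha> * n\<^sup>2 = \<alpha> * n\<^sup>2 * (\<alpha> * k)" by (simp add: k)
  finally have \<phi>\<alpha>: "\<phi> (\<alpha> *\<^sub>R w) =
    - (\<alpha> * n\<^sup>2 * (\<alpha> * k)) + 1 / 2 * (\<alpha> * n)\<^sup>2 + L / 6 * (\<alpha> * n)^3" .
  have \<phi>u: "\<phi> u = - X + 1 / 2 * q\<^sup>2 + L / 6 * q^3"
    by (simp add: \<phi>_def X_def q_def)
  show ?thesis
    unfolding \<phi>u \<phi>\<alpha> D' unfolding k_def q_def[symmetric] n_def[symmetric]
    by (simp add: field_simps power2_eq_square power3_eq_cube)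
qed

text \<open>
  The quotient is the positive root of \<open>L G \<alpha>\<^sup>2 / 2 + \<alpha> - 1 = 0\<close>.  At \<open>G = 0\<close> the equation becomes
  \<open>\<alpha> = 1\<close>, so the limit value needs no separate treatment later on.
\<close>

lemma stepsize_equation:
  fixes L G :: real
  assumes "L > 0" "G \<ge> 0"
  defines "\<alpha> \<equiv> if G = 0 then 1 else (- 1 + sqrt (1 + 2 * L * G)) / (L * G)"
  shows "\<alpha> > 0" "\<alpha> * (1 + L * \<alpha> * G / 2) = 1"
proof -
  define s where "s = sqrt (1 + 2 * L * G)"
  have s2: "s\<^sup>2 = 1 + 2 * L * G" using assms by (simp add: s_def)
  have "\<alpha> > 0 \<and> \<alpha> * (1 + L * \<alpha> * G / 2) = 1"
  proof (cases "G = 0")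
    case False
    with assms have LG: "L * G > 0" by simp
    then have "s > 1" unfolding s_def real_sqrt_gt_1_iff by linarith
    with False LG have pos: "\<alpha> > 0"
      unfolding \<alpha>_def s_def[symmetric] by (simp only: if_False) (intro divide_pos_pos; linarith)
    have aLG: "\<alpha> * (L * G) = s - 1" using False \<open>L > 0\<close> by (simp add: \<alpha>_def s_def[symmetric])
    have "\<alpha> * (1 + L * \<alpha> * G / 2) * (2 * (L * G)) = (\<alpha> * (L * G)) * (2 + \<alpha> * (L * G))"
      by (simp add: algebra_simps)
    also have "\<dots> = s\<^sup>2 - 1" unfolding aLG by (simp add: algebra_simps power2_eq_square)
    also have "\<dots> = 1 * (2 * (L * G))" by (simp add: s2)
    finally show ?thesis using pos False \<open>L > 0\<close> by simp
  qed (simp add: \<alpha>_def)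
  then show "\<alpha> > 0" "\<alpha> * (1 + L * \<alpha> * G / 2) = 1" by auto
qed

text \<open>
  Minimizers are characterized through \<open>S h\<close>, since \<open>h\<close> is determined only up to the kernel of
  \<open>S\<close>.  The gap formula shows that every value of the model exceeds the value at \<open>\<alpha> w\<close> by at least
  \<open>N (S h - \<alpha> w)\<^sup>2 / (2 \<alpha>)\<close>, and \<open>\<alpha> w = S (- \<alpha> d)\<close> is attained.
\<close>

lemma newton_model_minimizers:
  fixes f :: "real^'d \<Rightarrow> real" and S :: "real^'t^'d"
  assumes sym: "transpose (hessian f x) = hessian f x" and pd: "positive_definite (hessian f x)"
    and L: "L > 0"
  defines "d \<equiv> pseudoinverse (sketched_hessian f S x) *v sketched_gradient f S x"
  shows "is_arg_min (newton_model L f S x) (\<lambda>_. True) h \<longleftrightarrow>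
    S *v h = - stepsize L f S x *\<^sub>R (S *v d)"
proof -
  define H where "H = hessian f x"
  define N where "N = (\<lambda>v. sqrt ((H *v v) \<bullet> v))"
  define w where "w = - (S *v d)"
  define \<alpha> where "\<alpha> = stepsize L f S x"
  define \<phi> where "\<phi> = (\<lambda>v. - ((H *v w) \<bullet> v) + 1 / 2 * (N v)\<^sup>2 + L / 6 * (N v)^3)"
  have psd: "(H *v v) \<bullet> v \<ge> 0" for v
    using pd by (cases "v = 0") (auto simp: H_def positive_definite_def less_imp_le)
  have N_nonneg: "N v \<ge> 0" for v using psd by (simp add: N_def)
  have N0: "N v = 0 \<longleftrightarrow> v = 0" for v
    using pd unfolding N_def H_def positive_definite_def
    by (metis inner_zero_right less_irrefl real_sqrt_eq_zero_cancel_iff)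
  have normal: "transpose S *v (H *v (S *v d)) = sketched_gradient f S x"
    using mult_pseudoinverse_mult_vec_range[OF transpose_mult_vec_in_range_congruence
        [OF sym pd, of S "gradient f x"]]
    by (simp add: d_def H_def sketched_gradient_def sketched_hessian_def
        matrix_vector_mul_assoc matrix_mul_assoc)
  have Hw: "(H *v w) \<bullet> (S *v h) = - (sketched_gradient f S x \<bullet> h)" for h
  proof -
    have "(H *v w) \<bullet> (S *v h) = - ((H *v (S *v d)) \<bullet> (S *v h))"
      by (simp add: w_def linear_neg[OF matrix_vector_mul_linear])
    then show ?thesis by (simp add: inner_matrix_transpose normal)
  qed
  have model: "newton_model L f S x h = f x + \<phi> (S *v h)" for h
    by (simp add: newton_model_def local_norm_def \<phi>_def Hw N_def sketched_gradient_def
        inner_matrix_transpose[of "gradient f x"] flip: H_def)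
  have "(H *v w) \<bullet> w = (H *v (S *v d)) \<bullet> (S *v d)"
    by (simp add: w_def linear_neg[OF matrix_vector_mul_linear])
  then have G: "dual_norm f x S (sketched_gradient f S x) = N w"
    by (simp add: dual_norm_def N_def inner_matrix_transpose normal flip: d_def)
  have \<alpha>: "\<alpha> > 0" "\<alpha> * (1 + L * \<alpha> * N w / 2) = 1"
    using stepsize_equation[OF L N_nonneg[of w]]
    by (simp_all add: \<alpha>_def stepsize_def G Let_def)
  have gap: "\<phi> (S *v h) - \<phi> (\<alpha> *\<^sub>R w) = (N (S *v h - \<alpha> *\<^sub>R w))\<^sup>2 / (2 * \<alpha>)
      + L / 12 * (N (S *v h) - \<alpha> * N w)\<^sup>2 * (2 * N (S *v h) + \<alpha> * N w)" for h
    using cubic_model_gap[OF sym[folded H_def] psd \<alpha>(1), of L w "S *v h"] \<alpha>(2)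
    by (simp add: \<phi>_def N_def)
  have lower: "\<phi> (\<alpha> *\<^sub>R w) + (N (S *v h - \<alpha> *\<^sub>R w))\<^sup>2 / (2 * \<alpha>) \<le> \<phi> (S *v h)" for h
  proof -
    have "L / 12 * (N (S *v h) - \<alpha> * N w)\<^sup>2 * (2 * N (S *v h) + \<alpha> * N w) \<ge> 0"
      using L \<alpha>(1) N_nonneg by (intro mult_nonneg_nonneg add_nonneg_nonneg) auto
    then show ?thesis using gap[of h] by linarith
  qed
  have least: "\<phi> (\<alpha> *\<^sub>R w) \<le> \<phi> (S *v h)" for h
    using lower[of h] \<alpha>(1) by (smt (verit) divide_nonneg_pos zero_le_power2)
  have attained: "S *v (- \<alpha> *\<^sub>R d) = \<alpha> *\<^sub>R w"
    by (simp add: w_def matrix_vector_mult_scaleR flip: scaleR_minus_left)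
  have "is_arg_min (newton_model L f S x) (\<lambda>_. True) h \<longleftrightarrow> \<phi> (S *v h) \<le> \<phi> (\<alpha> *\<^sub>R w)"
    using least attained unfolding is_arg_min_def model by (smt (verit))
  also have "\<dots> \<longleftrightarrow> S *v h = \<alpha> *\<^sub>R w"
  proof
    assume "\<phi> (S *v h) \<le> \<phi> (\<alpha> *\<^sub>R w)"
    then have "(N (S *v h - \<alpha> *\<^sub>R w))\<^sup>2 / (2 * \<alpha>) \<le> 0"
      using lower[of h] by linarith
    then have "N (S *v h - \<alpha> *\<^sub>R w) = 0"
      using \<alpha>(1) by (simp add: divide_le_0_iff)
    then show "S *v h = \<alpha> *\<^sub>R w" by (simp add: N0)
  qed simp
  finally show ?thesis by (simp add: w_def \<alpha>_def)
qed

theorem theorem1: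
  fixes f :: "real^'d \<Rightarrow> real" and S :: "real^'t^'d" and x :: "real^'d" and L :: real
  assumes "convex_on UNIV f"
    and "twice_differentiable f"
    and "\<And>y. positive_definite (hessian f y)"
    and "bdd_below (range f)"
    and "L > 0"
    and "gradient f x \<in> matrix_range (hessian f x)"
  shows "(\<lambda>h. x + S *v h) ` {h. is_arg_min (newton_model L f S x) (\<lambda>_. True) h} =
           {x - stepsize L f S x *\<^sub>R
                (S *v (pseudoinverse (sketched_hessian f S x) *v sketched_gradient f S x))}
       \<and> x - stepsize L f S x *\<^sub>R
             (S *v (pseudoinverse (sketched_hessian f S x) *v sketched_gradient f S x)) =
         x - stepsize L f S x *\<^sub>R
             (projection_matrix f S x *v (pseudoinverse (hessian f x) *v gradient f x))
       \<and> is_projection_onto (local_norm f x) (matrix_range S) (projection_matrix f S x)"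
proof (intro conjI)
  define d where "d = pseudoinverse (sketched_hessian f S x) *v sketched_gradient f S x"
  have sym: "transpose (hessian f x) = hessian f x"
    by (rule transpose_hessian) fact
  note pd = assms(3)[of x]
  have iff: "is_arg_min (newton_model L f S x) (\<lambda>_. True) h \<longleftrightarrow>
      S *v h = S *v (- stepsize L f S x *\<^sub>R d)" for h
    using newton_model_minimizers[OF sym pd \<open>L > 0\<close>]
    by (simp add: d_def matrix_vector_mult_scaleR linear_neg[OF matrix_vector_mul_linear])
  have "(\<lambda>h. x + S *v h) ` {h. S *v h = S *v (- stepsize L f S x *\<^sub>R d)} =
      {x + S *v (- stepsize L f S x *\<^sub>R d)}"
    by auto
  then show "(\<lambda>h. x + S *v h) ` {h. is_arg_min (newton_model L f S x) (\<lambda>_. True) h} =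
      {x - stepsize L f S x *\<^sub>R
        (S *v (pseudoinverse (sketched_hessian f S x) *v sketched_gradient f S x))}"
    by (simp add: iff matrix_vector_mult_scaleR linear_neg[OF matrix_vector_mul_linear]
        flip: d_def)
  have "hessian f x *v (pseudoinverse (hessian f x) *v gradient f x) = gradient f x"
    using assms(6) by (rule mult_pseudoinverse_mult_vec_range)
  then have "projection_matrix f S x *v (pseudoinverse (hessian f x) *v gradient f x) =
      S *v (pseudoinverse (sketched_hessian f S x) *v sketched_gradient f S x)"
    by (simp add: projection_matrix_def sketched_hessian_def sketched_gradient_def
        flip: matrix_vector_mul_assoc)
  then show "x - stepsize L f S x *\<^sub>R
        (S *v (pseudoinverse (sketched_hessian f S x) *v sketched_gradient f S x)) =
      x - stepsize L f S x *\<^sub>R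
        (projection_matrix f S x *v (pseudoinverse (hessian f x) *v gradient f x))"
    by simp
  show "is_projection_onto (local_norm f x) (matrix_range S) (projection_matrix f S x)"
    using sym pd by (rule projection_matrix_is_projection)
qed

end
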